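(* Every reflexive relation in the category $\mathsf{MV}_{\mathsf{lf}}$ of locally finite MV-algebras is an effective equivalence relation. Thus in particular $\mathsf{MV}_{\mathsf{lf}}$ is a Mal'tsev category.
   Context: MV-algebras: an MV-algebra is an algebra $\langle A,\oplus,\neg,0\rangle$ such that $\langle A,\oplus,0\rangle$ is a monoid, $\neg\neg x=x$, $\neg 0\oplus x=\neg 0$, and $\neg(\neg x\oplus y)\oplus y=\neg(\neg y\oplus x)\oplus x$. An MV-algebra is locally finite if each of its finitely generated subalgebras is finite. $\mathsf{MV}_{\mathsf{lf}}$ has all locally finite MV-algebras as objects and all MV-homomorphisms between them as arrows. Internal relations: in a category with finite limits, a relation on an object $A$ is a subobject $\langle p_0,p_1\rangle\colon R\to A\times A$ (a monic arrow). It is reflexive if the diagonal $\langle 1_A,1_A\rangle$ factors through it; symmetric if $\langle p_1,p_0\rangle$ factors through it; transitive if, for the pullback $P$ of $p_1\colon R\to A$ and $p_0\colon R\to A$ with projections $\pi_0,\pi_1\colon P\to R$ satisfying $p_1\circ\pi_0=p_0\circ\pi_1$, the arrow $\langle p_0\circ\pi_0,p_1\circ\pi_1\rangle\colon P\to A\times A$ factors through it. An equivalence relation is a reflexive, symmetric and transitive relation. An equivalence relation is effective if $p_0,p_1\colon R\rightrightarrows A$ is the kernel pair (pullback along itself) of some arrow $q\colon A\to S$. A category is Mal'tsev if it has finite limits and every reflexive relation in it is an equivalence relation.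
   Formalization: "Monoid" in the definition of MV-algebra is taken as commutative monoid (with only ¬0⊕x=¬0 the claim fails on a three-element algebra); the algebras are those carried by subsets of an arbitrary infinite set, which contains every case up to isomorphism. *)

theory Defs
  imports "HOL-Algebra.Group" "HOL-Library.FuncSet"
begin

section \<open>Categories\<close>

record ('o, 'm) cat =
  Ob :: "'o set"
  Ar :: "'m set"
  Dom :: "'m \<Rightarrow> 'o"
  Cod :: "'m \<Rightarrow> 'o"
  Id :: "'o \<Rightarrow> 'm"
  Comp :: "'m \<Rightarrow> 'm \<Rightarrow> 'm"  (infixr "\<cdot>\<index>" 70)

definition Hom :: "('o, 'm) cat \<Rightarrow> 'o \<Rightarrow> 'o \<Rightarrow> 'm set" where
  "Hom C A B = {f \<in> Ar C. Dom C f = A \<and> Cod C f = B}"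

locale category =
  fixes C :: "('o, 'm) cat" (structure)
  assumes Dom_Ob: "f \<in> Ar C \<Longrightarrow> Dom C f \<in> Ob C"
    and Cod_Ob: "f \<in> Ar C \<Longrightarrow> Cod C f \<in> Ob C"
    and Id_Hom: "A \<in> Ob C \<Longrightarrow> Id C A \<in> Hom C A A"
    and Comp_Hom: "f \<in> Hom C A B \<Longrightarrow> g \<in> Hom C B D \<Longrightarrow> g \<cdot> f \<in> Hom C A D"
    and Comp_Id: "f \<in> Hom C A B \<Longrightarrow> f \<cdot> Id C A = f"
    and Id_Comp: "f \<in> Hom C A B \<Longrightarrow> Id C B \<cdot> f = f"
    and Comp_assoc:
      "f \<in> Hom C A B \<Longrightarrow> g \<in> Hom C B D \<Longrightarrow> h \<in> Hom C D E \<Longrightarrow> (h \<cdot> g) \<cdot> f = h \<cdot> (g \<cdot> f)"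

definition monic :: "('o, 'm) cat \<Rightarrow> 'm \<Rightarrow> bool" where
  "monic C m \<longleftrightarrow> m \<in> Ar C \<and>
     (\<forall>X. \<forall>f \<in> Hom C X (Dom C m). \<forall>g \<in> Hom C X (Dom C m).
        m \<cdot>\<^bsub>C\<^esub> f = m \<cdot>\<^bsub>C\<^esub> g \<longrightarrow> f = g)"

definition factors_through :: "('o, 'm) cat \<Rightarrow> 'm \<Rightarrow> 'm \<Rightarrow> bool" where
  "factors_through C f m \<longleftrightarrow> (\<exists>h \<in> Hom C (Dom C f) (Dom C m). m \<cdot>\<^bsub>C\<^esub> h = f)"


subsection \<open>Finite limits\<close>

locale functor_between = J: category J + C: category C
  for J :: "('i, 'j) cat" and C :: "('o, 'm) cat"
    and Fo :: "'i \<Rightarrow> 'o" and Fa :: "'j \<Rightarrow> 'm" +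
  assumes map_Ob: "i \<in> Ob J \<Longrightarrow> Fo i \<in> Ob C"
    and map_Hom: "u \<in> Hom J i j \<Longrightarrow> Fa u \<in> Hom C (Fo i) (Fo j)"
    and map_Id: "i \<in> Ob J \<Longrightarrow> Fa (Id J i) = Id C (Fo i)"
    and map_Comp: "u \<in> Hom J i j \<Longrightarrow> v \<in> Hom J j k \<Longrightarrow>
      Fa (v \<cdot>\<^bsub>J\<^esub> u) = Fa v \<cdot>\<^bsub>C\<^esub> Fa u"

definition is_cone ::
  "('i, 'j) cat \<Rightarrow> ('o, 'm) cat \<Rightarrow> ('i \<Rightarrow> 'o) \<Rightarrow> ('j \<Rightarrow> 'm) \<Rightarrow> 'o \<Rightarrow> ('i \<Rightarrow> 'm) \<Rightarrow> bool" where
  "is_cone J C Fo Fa L \<pi> \<longleftrightarrow> L \<in> Ob C \<and>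
     (\<forall>i \<in> Ob J. \<pi> i \<in> Hom C L (Fo i)) \<and>
     (\<forall>i \<in> Ob J. \<forall>j \<in> Ob J. \<forall>u \<in> Hom J i j. Fa u \<cdot>\<^bsub>C\<^esub> \<pi> i = \<pi> j)"

definition is_limit ::
  "('i, 'j) cat \<Rightarrow> ('o, 'm) cat \<Rightarrow> ('i \<Rightarrow> 'o) \<Rightarrow> ('j \<Rightarrow> 'm) \<Rightarrow> 'o \<Rightarrow> ('i \<Rightarrow> 'm) \<Rightarrow> bool" where
  "is_limit J C Fo Fa L \<pi> \<longleftrightarrow> is_cone J C Fo Fa L \<pi> \<and>
     (\<forall>M \<mu>. is_cone J C Fo Fa M \<mu> \<longrightarrow>
        (\<exists>!h. h \<in> Hom C M L \<and> (\<forall>i \<in> Ob J. \<pi> i \<cdot>\<^bsub>C\<^esub> h = \<mu> i)))"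

text \<open>Index categories with objects and arrows in \<^typ>\<open>nat\<close> represent all finite categories
  up to isomorphism.\<close>

definition has_finite_limits :: "('o, 'm) cat \<Rightarrow> bool" where
  "has_finite_limits C \<longleftrightarrow>
     (\<forall>(J :: (nat, nat) cat) Fo Fa.
        finite (Ob J) \<and> finite (Ar J) \<and> functor_between J C Fo Fa \<longrightarrow>
        (\<exists>L \<pi>. is_limit J C Fo Fa L \<pi>))"

definition is_product ::
  "('o, 'm) cat \<Rightarrow> 'o \<Rightarrow> 'o \<Rightarrow> 'o \<Rightarrow> 'm \<Rightarrow> 'm \<Rightarrow> bool" where
  "is_product C A B P q0 q1 \<longleftrightarrow> q0 \<in> Hom C P A \<and> q1 \<in> Hom C P B \<and>
     (\<forall>X. \<forall>f \<in> Hom C X A. \<forall>g \<in> Hom C X B.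
        \<exists>!h. h \<in> Hom C X P \<and> q0 \<cdot>\<^bsub>C\<^esub> h = f \<and> q1 \<cdot>\<^bsub>C\<^esub> h = g)"

definition pairing ::
  "('o, 'm) cat \<Rightarrow> 'o \<Rightarrow> 'm \<Rightarrow> 'm \<Rightarrow> 'm \<Rightarrow> 'm \<Rightarrow> 'm" where
  "pairing C P q0 q1 f g =
     (THE h. h \<in> Hom C (Dom C f) P \<and> q0 \<cdot>\<^bsub>C\<^esub> h = f \<and> q1 \<cdot>\<^bsub>C\<^esub> h = g)"

definition is_pullback ::
  "('o, 'm) cat \<Rightarrow> 'm \<Rightarrow> 'm \<Rightarrow> 'o \<Rightarrow> 'm \<Rightarrow> 'm \<Rightarrow> bool" where
  "is_pullback C f g P t0 t1 \<longleftrightarrow> f \<in> Ar C \<and> g \<in> Ar C \<and> Cod C f = Cod C g \<and>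
     t0 \<in> Hom C P (Dom C f) \<and> t1 \<in> Hom C P (Dom C g) \<and> f \<cdot>\<^bsub>C\<^esub> t0 = g \<cdot>\<^bsub>C\<^esub> t1 \<and>
     (\<forall>X. \<forall>x0 \<in> Hom C X (Dom C f). \<forall>x1 \<in> Hom C X (Dom C g).
        f \<cdot>\<^bsub>C\<^esub> x0 = g \<cdot>\<^bsub>C\<^esub> x1 \<longrightarrow>
        (\<exists>!h. h \<in> Hom C X P \<and> t0 \<cdot>\<^bsub>C\<^esub> h = x0 \<and> t1 \<cdot>\<^bsub>C\<^esub> h = x1))"


subsection \<open>Internal relations\<close>

text \<open>A relation \<open>\<langle>p0, p1\<rangle> : R \<rightarrow> A \<times> A\<close> is given together with a choice \<open>(P, q0, q1)\<close> of the
  product \<open>A \<times> A\<close>; statements about relations are meant for all such choices.\<close>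

definition is_relation ::
  "('o, 'm) cat \<Rightarrow> 'o \<Rightarrow> 'o \<Rightarrow> 'm \<Rightarrow> 'm \<Rightarrow> 'o \<Rightarrow> 'm \<Rightarrow> 'm \<Rightarrow> bool" where
  "is_relation C A P q0 q1 R p0 p1 \<longleftrightarrow>
     is_product C A A P q0 q1 \<and> p0 \<in> Hom C R A \<and> p1 \<in> Hom C R A \<and>
     monic C (pairing C P q0 q1 p0 p1)"

definition reflexive_relation ::
  "('o, 'm) cat \<Rightarrow> 'o \<Rightarrow> 'o \<Rightarrow> 'm \<Rightarrow> 'm \<Rightarrow> 'o \<Rightarrow> 'm \<Rightarrow> 'm \<Rightarrow> bool" where
  "reflexive_relation C A P q0 q1 R p0 p1 \<longleftrightarrow>
     is_relation C A P q0 q1 R p0 p1 \<and>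
     factors_through C (pairing C P q0 q1 (Id C A) (Id C A)) (pairing C P q0 q1 p0 p1)"

definition symmetric_relation ::
  "('o, 'm) cat \<Rightarrow> 'o \<Rightarrow> 'o \<Rightarrow> 'm \<Rightarrow> 'm \<Rightarrow> 'o \<Rightarrow> 'm \<Rightarrow> 'm \<Rightarrow> bool" where
  "symmetric_relation C A P q0 q1 R p0 p1 \<longleftrightarrow>
     is_relation C A P q0 q1 R p0 p1 \<and>
     factors_through C (pairing C P q0 q1 p1 p0) (pairing C P q0 q1 p0 p1)"

text \<open>Pullbacks are unique up to isomorphism, so quantifying over all of them is the same as
  choosing one as soon as the category has pullbacks.\<close>

definition transitive_relation ::
  "('o, 'm) cat \<Rightarrow> 'o \<Rightarrow> 'o \<Rightarrow> 'm \<Rightarrow> 'm \<Rightarrow> 'o \<Rightarrow> 'm \<Rightarrow> 'm \<Rightarrow> bool" where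
  "transitive_relation C A P q0 q1 R p0 p1 \<longleftrightarrow>
     is_relation C A P q0 q1 R p0 p1 \<and>
     (\<forall>T t0 t1. is_pullback C p1 p0 T t0 t1 \<longrightarrow>
        factors_through C (pairing C P q0 q1 (p0 \<cdot>\<^bsub>C\<^esub> t0) (p1 \<cdot>\<^bsub>C\<^esub> t1))
          (pairing C P q0 q1 p0 p1))"

definition equivalence_relation ::
  "('o, 'm) cat \<Rightarrow> 'o \<Rightarrow> 'o \<Rightarrow> 'm \<Rightarrow> 'm \<Rightarrow> 'o \<Rightarrow> 'm \<Rightarrow> 'm \<Rightarrow> bool" where
  "equivalence_relation C A P q0 q1 R p0 p1 \<longleftrightarrow>
     reflexive_relation C A P q0 q1 R p0 p1 \<and>
     symmetric_relation C A P q0 q1 R p0 p1 \<and>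
     transitive_relation C A P q0 q1 R p0 p1"

definition effective_equivalence_relation ::
  "('o, 'm) cat \<Rightarrow> 'o \<Rightarrow> 'o \<Rightarrow> 'm \<Rightarrow> 'm \<Rightarrow> 'o \<Rightarrow> 'm \<Rightarrow> 'm \<Rightarrow> bool" where
  "effective_equivalence_relation C A P q0 q1 R p0 p1 \<longleftrightarrow>
     equivalence_relation C A P q0 q1 R p0 p1 \<and>
     (\<exists>S. \<exists>q \<in> Hom C A S. is_pullback C q q R p0 p1)"

definition maltsev_category :: "('o, 'm) cat \<Rightarrow> bool" where
  "maltsev_category C \<longleftrightarrow> category C \<and> has_finite_limits C \<and>
     (\<forall>A P q0 q1 R p0 p1. reflexive_relation C A P q0 q1 R p0 p1 \<longrightarrow>
        equivalence_relation C A P q0 q1 R p0 p1)"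


section \<open>MV-algebras\<close>

record 'a mv_alg = "'a partial_object" +
  mv_plus :: "'a \<Rightarrow> 'a \<Rightarrow> 'a"  (infixl "\<oplus>\<index>" 65)
  mv_neg :: "'a \<Rightarrow> 'a"  ("\<sim>\<index> _" [81] 80)
  mv_zero :: 'a  ("\<zero>\<index>")

text \<open>As is standard for MV-algebras, ``monoid'' means commutative monoid. With the last axiom
  written as \<open>\<sim> \<zero> \<oplus> x = \<sim> \<zero>\<close>, commutativity does not follow from the other
  axioms: let \<open>\<zero>\<close> be neutral on \<open>{\<zero>, u, a}\<close>, let \<open>u \<oplus> x = u\<close> and \<open>a \<oplus> x = a\<close> for all \<open>x\<close>,
  and let \<open>\<sim>\<close> swap \<open>\<zero>\<close> and \<open>u\<close> and fix \<open>a\<close>.\<close>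

locale mv_algebra =
  fixes A :: "'a mv_alg" (structure)
  assumes monoid: "comm_monoid \<lparr>carrier = carrier A, monoid.mult = (\<oplus>), one = \<zero>\<rparr>"
    and neg_closed: "x \<in> carrier A \<Longrightarrow> \<sim> x \<in> carrier A"
    and neg_neg: "x \<in> carrier A \<Longrightarrow> \<sim> (\<sim> x) = x"
    and neg_zero_plus: "x \<in> carrier A \<Longrightarrow> \<sim> \<zero> \<oplus> x = \<sim> \<zero>"
    and Lukasiewicz: "x \<in> carrier A \<Longrightarrow> y \<in> carrier A \<Longrightarrow>
      \<sim> (\<sim> x \<oplus> y) \<oplus> y = \<sim> (\<sim> y \<oplus> x) \<oplus> x"

definition mv_subalgebra :: "'a set \<Rightarrow> 'a mv_alg \<Rightarrow> bool" where
  "mv_subalgebra B A \<longleftrightarrow> B \<subseteq> carrier A \<and> \<zero>\<^bsub>A\<^esub> \<in> B \<and>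
     (\<forall>x \<in> B. \<sim>\<^bsub>A\<^esub> x \<in> B) \<and> (\<forall>x \<in> B. \<forall>y \<in> B. x \<oplus>\<^bsub>A\<^esub> y \<in> B)"

definition mv_generated :: "'a mv_alg \<Rightarrow> 'a set \<Rightarrow> 'a set" where
  "mv_generated A X = \<Inter>{B. mv_subalgebra B A \<and> X \<subseteq> B}"

definition locally_finite :: "'a mv_alg \<Rightarrow> bool" where
  "locally_finite A \<longleftrightarrow>
     (\<forall>X. X \<subseteq> carrier A \<and> finite X \<longrightarrow> finite (mv_generated A X))"

definition mv_hom :: "'a mv_alg \<Rightarrow> 'b mv_alg \<Rightarrow> ('a \<Rightarrow> 'b) \<Rightarrow> bool" where
  "mv_hom A B f \<longleftrightarrow> f \<in> carrier A \<rightarrow> carrier B \<and> f \<zero>\<^bsub>A\<^esub> = \<zero>\<^bsub>B\<^esub> \<and>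
     (\<forall>x \<in> carrier A. f (\<sim>\<^bsub>A\<^esub> x) = \<sim>\<^bsub>B\<^esub> (f x)) \<and>
     (\<forall>x \<in> carrier A. \<forall>y \<in> carrier A. f (x \<oplus>\<^bsub>A\<^esub> y) = f x \<oplus>\<^bsub>B\<^esub> f y)"


subsection \<open>The category of locally finite MV-algebras\<close>

record 'a mv_arrow =
  src :: "'a mv_alg"
  tgt :: "'a mv_alg"
  map_of_arrow :: "'a \<Rightarrow> 'a"

text \<open>The objects are the locally finite MV-algebras whose carrier is a set of elements of
  \<^typ>\<open>'a\<close>, which plays the role of the universe; it has to be infinite for finite products to
  exist. Underlying maps are extensional, so that arrows with the same source and target
  are equal if and only if they agree on the carrier of the source. Operations of an object are
  unconstrained outside its carrier; algebras that differ only there are isomorphic objects.\<close>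

definition MV_lf :: "('a mv_alg, 'a mv_arrow) cat" where
  "MV_lf =
    \<lparr>Ob = {A. mv_algebra A \<and> locally_finite A},
     Ar = {f. mv_algebra (src f) \<and> locally_finite (src f) \<and>
              mv_algebra (tgt f) \<and> locally_finite (tgt f) \<and>
              mv_hom (src f) (tgt f) (map_of_arrow f) \<and>
              map_of_arrow f \<in> extensional (carrier (src f))},
     Dom = src,
     Cod = tgt,
     Id = (\<lambda>A. \<lparr>src = A, tgt = A, map_of_arrow = restrict id (carrier A)\<rparr>),
     Comp = (\<lambda>g f. \<lparr>src = src f, tgt = tgt g,
       map_of_arrow = compose (carrier (src f)) (map_of_arrow g) (map_of_arrow f)\<rparr>)\<rparr>"

end

theory Submission
  imports Defs
begin

text \<open>With \<open>x \<rightarrow> y = \<sim> x \<oplus> y\<close>, the term \<open>((x \<rightarrow> y) \<rightarrow> z) \<and> ((z \<rightarrow> y) \<rightarrow> x)\<close> is a Maltsev term for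
  MV-algebras, because \<open>(x \<rightarrow> y) \<rightarrow> y = x \<or> y\<close>. Hence every reflexive subalgebra of \<open>A \<times> A\<close> is a
  congruence, namely the kernel of the quotient map. Local finiteness matters only in that it is
  inherited by quotients and by subalgebras of finite products. The latter live in the infinite
  universe \<open>'a\<close> via an injection of \<open>'a \<times> 'a\<close> into \<open>'a\<close>; the one for the kernel pair of a
  jointly monic pair of arrows shows that the pair is jointly injective.\<close>


section \<open>MV-algebras\<close>

context mv_algebra
begin

lemma zero_closed [simp]: "\<zero> \<in> carrier A"
  using comm_monoid.axioms(1)[OF monoid] monoid.one_closed by fastforce

lemma plus_closed [simp]: "x \<in> carrier A \<Longrightarrow> y \<in> carrier A \<Longrightarrow> x \<oplus> y \<in> carrier A"
  using monoid.m_closed[OF comm_monoid.axioms(1)[OF monoid], of x y] by simp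

lemma plus_assoc:
  "x \<in> carrier A \<Longrightarrow> y \<in> carrier A \<Longrightarrow> z \<in> carrier A \<Longrightarrow> x \<oplus> y \<oplus> z = x \<oplus> (y \<oplus> z)"
  using monoid.m_assoc[OF comm_monoid.axioms(1)[OF monoid], of x y z] by simp

lemma plus_comm: "x \<in> carrier A \<Longrightarrow> y \<in> carrier A \<Longrightarrow> x \<oplus> y = y \<oplus> x"
  using comm_monoid.m_comm[OF monoid, of x y] by simp

lemma zero_plus [simp]: "x \<in> carrier A \<Longrightarrow> \<zero> \<oplus> x = x"
  using monoid.l_one[OF comm_monoid.axioms(1)[OF monoid], of x] by simp

lemmas [simp] = neg_closed neg_neg neg_zero_plus

text \<open>Put \<open>\<sim> \<zero>\<close>, the top element, for \<open>y\<close> in the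
  Lukasiewicz axiom: the left side collapses to \<open>\<sim> \<zero>\<close>, the right side to
  \<open>\<sim> x \<oplus> x\<close>.\<close>

lemma neg_plus_self [simp]: "x \<in> carrier A \<Longrightarrow> \<sim> x \<oplus> x = \<sim> \<zero>"
  using Lukasiewicz[of x "\<sim> \<zero>"] plus_comm[of _ "\<sim> \<zero>"] by simp

lemma plus_neg_self [simp]: "x \<in> carrier A \<Longrightarrow> x \<oplus> \<sim> x = \<sim> \<zero>"
  using plus_comm[of x "\<sim> x"] by simp

end

lemma mv_algebraI:
  fixes A :: "'a mv_alg" (structure)
  assumes "\<zero> \<in> carrier A"
    and "\<And>x y. x \<in> carrier A \<Longrightarrow> y \<in> carrier A \<Longrightarrow> x \<oplus> y \<in> carrier A"
    and "\<And>x y z. x \<in> carrier A \<Longrightarrow> y \<in> carrier A \<Longrightarrow> z \<in> carrier A \<Longrightarrow> x \<oplus> y \<oplus> z = x \<oplus> (y \<oplus> z)"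
    and "\<And>x y. x \<in> carrier A \<Longrightarrow> y \<in> carrier A \<Longrightarrow> x \<oplus> y = y \<oplus> x"
    and "\<And>x. x \<in> carrier A \<Longrightarrow> \<zero> \<oplus> x = x"
    and "\<And>x. x \<in> carrier A \<Longrightarrow> \<sim> x \<in> carrier A"
    and "\<And>x. x \<in> carrier A \<Longrightarrow> \<sim> (\<sim> x) = x"
    and "\<And>x. x \<in> carrier A \<Longrightarrow> \<sim> \<zero> \<oplus> x = \<sim> \<zero>"
    and "\<And>x y. x \<in> carrier A \<Longrightarrow> y \<in> carrier A \<Longrightarrow>
      \<sim> (\<sim> x \<oplus> y) \<oplus> y = \<sim> (\<sim> y \<oplus> x) \<oplus> x"
  shows "mv_algebra A"
proof (rule mv_algebra.intro)
  show "comm_monoid \<lparr>carrier = carrier A, monoid.mult = (\<oplus>), one = \<zero>\<rparr>"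
    by (rule comm_monoidI) (use assms(1-5) in auto)
qed (use assms(6-9) in auto)

text \<open>\<open>meet\<close> is the lattice meet, the De Morgan dual of the join
  \<open>\<sim> (\<sim> a \<oplus> b) \<oplus> b\<close>.\<close>

definition mv_maltsev :: "'a mv_alg \<Rightarrow> 'a \<Rightarrow> 'a \<Rightarrow> 'a \<Rightarrow> 'a" where
  "mv_maltsev A x y z =
     (let imp = (\<lambda>a b. \<sim>\<^bsub>A\<^esub> a \<oplus>\<^bsub>A\<^esub> b);
          meet = (\<lambda>a b. \<sim>\<^bsub>A\<^esub> (\<sim>\<^bsub>A\<^esub> (a \<oplus>\<^bsub>A\<^esub> \<sim>\<^bsub>A\<^esub> b) \<oplus>\<^bsub>A\<^esub> \<sim>\<^bsub>A\<^esub> b))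
      in meet (imp (imp x y) z) (imp (imp z y) x))"

context mv_algebra
begin

lemma maltsev_closed:
  "x \<in> carrier A \<Longrightarrow> y \<in> carrier A \<Longrightarrow> z \<in> carrier A \<Longrightarrow> mv_maltsev A x y z \<in> carrier A"
  by (simp add: mv_maltsev_def Let_def)

text \<open>In order terms, \<open>z\<close> lies below the join of \<open>x\<close> and
  \<open>z\<close>, as \<open>u \<le> v\<close> means
  \<open>\<sim> u \<oplus> v = \<sim> \<zero>\<close>. Regrouping exposes
  \<open>z \<oplus> \<sim> z\<close>, the absorbing top element. The Lukasiewicz axiom,
  commutativity of the join, yields the second form.\<close>

lemma join_plus_neg:
  assumes "x \<in> carrier A" "z \<in> carrier A"
  shows "\<sim> (\<sim> x \<oplus> z) \<oplus> z \<oplus> \<sim> z = \<sim> \<zero>" "\<sim> (\<sim> z \<oplus> x) \<oplus> x \<oplus> \<sim> z = \<sim> \<zero>"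
proof -
  show "\<sim> (\<sim> x \<oplus> z) \<oplus> z \<oplus> \<sim> z = \<sim> \<zero>"
    using assms by (simp add: plus_assoc plus_comm[of _ "\<sim> \<zero>"])
  then show "\<sim> (\<sim> z \<oplus> x) \<oplus> x \<oplus> \<sim> z = \<sim> \<zero>"
    using assms Lukasiewicz[of x z] by simp
qed

lemma maltsev_left:
  assumes "x \<in> carrier A" "z \<in> carrier A"
  shows "mv_maltsev A x x z = z"
proof -
  \<comment> \<open>The term reduces to the meet of \<open>z\<close> with \<open>?v\<close>, the
    join of \<open>z\<close> and \<open>x\<close>. Its negation is a join of negations; swapping
    these two brings out \<open>?v \<oplus> \<sim> z\<close>, which is the top.\<close>
  let ?v = "\<sim> (\<sim> z \<oplus> x) \<oplus> x"
  have "\<sim> (z \<oplus> \<sim> ?v) \<oplus> \<sim> ?v = \<sim> (?v \<oplus> \<sim> z) \<oplus> \<sim> z"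
    using assms Lukasiewicz[of "\<sim> z" "\<sim> ?v"] by simp
  also have "\<dots> = \<sim> z"
    using assms by (simp add: join_plus_neg)
  finally show ?thesis
    using assms by (simp add: mv_maltsev_def Let_def)
qed

text \<open>This is the meet of the join of \<open>x\<close> and \<open>z\<close> with
  \<open>x\<close>, taken in the order to which \<open>join_plus_neg\<close> applies without a
  swap.\<close>

lemma maltsev_right:
  assumes "x \<in> carrier A" "z \<in> carrier A"
  shows "mv_maltsev A x z z = x"
  using assms by (simp add: mv_maltsev_def Let_def join_plus_neg)

end

section \<open>Homomorphisms and jointly injective families\<close>

lemma mv_hom_closed: "mv_hom A B f \<Longrightarrow> x \<in> carrier A \<Longrightarrow> f x \<in> carrier B"
  by (auto simp: mv_hom_def)

lemma mv_hom_maltsev: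
  assumes "mv_algebra A" "mv_hom A B f" "x \<in> carrier A" "y \<in> carrier A" "z \<in> carrier A"
  shows "f (mv_maltsev A x y z) = mv_maltsev B (f x) (f y) (f z)"
proof -
  interpret mv_algebra A by fact
  show ?thesis
    using assms by (simp add: mv_maltsev_def Let_def mv_hom_def)
qed

lemma mv_hom_compose:
  "mv_hom A B f \<Longrightarrow> mv_hom B D g \<Longrightarrow> mv_hom A D (\<lambda>x. g (f x))"
  unfolding mv_hom_def by (auto simp: Pi_iff)

lemma mv_hom_cong:
  assumes "mv_algebra A" "\<And>x. x \<in> carrier A \<Longrightarrow> f x = g x"
  shows "mv_hom A B f \<longleftrightarrow> mv_hom A B g"
proof -
  interpret mv_algebra A by fact
  show ?thesis
    using assms(2) by (simp add: mv_hom_def Pi_iff)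
qed

lemma mv_hom_restrict [simp]: "mv_algebra A \<Longrightarrow> mv_hom A B (restrict f (carrier A)) \<longleftrightarrow> mv_hom A B f"
  by (rule mv_hom_cong) auto

text \<open>The common source of universal properties: existence gives a pointwise lift
  \<open>h\<close>, and \<open>h\<close> respects the operations because each required equation
  holds after every \<open>\<pi> i\<close> and these are jointly injective.\<close>

lemma mv_hom_factor:
  assumes M: "mv_algebra M" and L: "mv_algebra L"
    and \<pi>: "\<And>i. i \<in> I \<Longrightarrow> mv_hom L (F i) (\<pi> i)"
    and \<mu>: "\<And>i. i \<in> I \<Longrightarrow> mv_hom M (F i) (\<mu> i)"
    and inj: "\<And>x y. x \<in> carrier L \<Longrightarrow> y \<in> carrier L \<Longrightarrow> (\<And>i. i \<in> I \<Longrightarrow> \<pi> i x = \<pi> i y) \<Longrightarrow> x = y"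
    and ex: "\<And>m. m \<in> carrier M \<Longrightarrow> \<exists>x \<in> carrier L. \<forall>i \<in> I. \<pi> i x = \<mu> i m"
  obtains h where "mv_hom M L h" "\<And>i m. i \<in> I \<Longrightarrow> m \<in> carrier M \<Longrightarrow> \<pi> i (h m) = \<mu> i m"
proof -
  interpret M: mv_algebra M by fact
  interpret L: mv_algebra L by fact
  obtain h where h: "\<And>m. m \<in> carrier M \<Longrightarrow> h m \<in> carrier L"
    "\<And>i m. m \<in> carrier M \<Longrightarrow> i \<in> I \<Longrightarrow> \<pi> i (h m) = \<mu> i m"
    using ex by metis
  have "mv_hom M L h"
    unfolding mv_hom_def
  proof (intro conjI ballI)
    show "h \<zero>\<^bsub>M\<^esub> = \<zero>\<^bsub>L\<^esub>"
      by (rule inj) (use h \<pi> \<mu> in \<open>auto simp: mv_hom_def\<close>)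
  next
    fix x assume x: "x \<in> carrier M"
    show "h (\<sim>\<^bsub>M\<^esub> x) = \<sim>\<^bsub>L\<^esub> h x"
      by (rule inj) (use h \<pi> \<mu> x in \<open>auto simp: mv_hom_def\<close>)
    fix y assume y: "y \<in> carrier M"
    show "h (x \<oplus>\<^bsub>M\<^esub> y) = h x \<oplus>\<^bsub>L\<^esub> h y"
      by (rule inj) (use h \<pi> \<mu> x y in \<open>auto simp: mv_hom_def\<close>)
  qed (use h in auto)
  with h(2) that show thesis by blast
qed


section \<open>Local finiteness\<close>

lemma mv_generated_least:
  "mv_subalgebra B A \<Longrightarrow> X \<subseteq> B \<Longrightarrow> mv_generated A X \<subseteq> B"
  by (auto simp: mv_generated_def)

lemma mv_subalgebra_carrier: "mv_algebra A \<Longrightarrow> mv_subalgebra (carrier A) A"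
  by (simp add: mv_subalgebra_def mv_algebra.zero_closed mv_algebra.plus_closed mv_algebra.neg_closed)

lemma mv_subalgebra_generated:
  assumes "mv_algebra A" "X \<subseteq> carrier A"
  shows "mv_subalgebra (mv_generated A X) A"
proof -
  have "mv_generated A X \<subseteq> carrier A"
    using assms by (intro mv_generated_least mv_subalgebra_carrier)
  then show ?thesis
    by (auto simp: mv_subalgebra_def mv_generated_def)
qed

lemma generators_subset: "X \<subseteq> mv_generated A X"
  by (auto simp: mv_generated_def)

text \<open>Any finite subalgebra around \<open>X\<close> bounds the generated one, so generated
  subalgebras of images and products need not be determined.\<close>

lemma locally_finiteI:
  assumes "\<And>X. X \<subseteq> carrier A \<Longrightarrow> finite X \<Longrightarrow> \<exists>B. finite B \<and> mv_subalgebra B A \<and> X \<subseteq> B"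
  shows "locally_finite A"
  unfolding locally_finite_def using assms mv_generated_least finite_subset by metis

lemma locally_finiteE:
  assumes "locally_finite A" "mv_algebra A" "X \<subseteq> carrier A" "finite X"
  obtains B where "finite B" "mv_subalgebra B A" "X \<subseteq> B"
  using assms mv_subalgebra_generated generators_subset unfolding locally_finite_def by metis

lemma mv_subalgebra_image:
  assumes "mv_hom A B f" "mv_subalgebra S A"
  shows "mv_subalgebra (f ` S) B"
  unfolding mv_subalgebra_def
proof (intro conjI ballI)
  show "f ` S \<subseteq> carrier B"
    using assms by (auto simp: mv_hom_def mv_subalgebra_def)
  show "\<zero>\<^bsub>B\<^esub> \<in> f ` S"
    using assms by (metis imageI mv_hom_def mv_subalgebra_def)
next
  fix u assume "u \<in> f ` S"
  then obtain x where x: "x \<in> S" "u = f x" by blast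
  then have "\<sim>\<^bsub>B\<^esub> u = f (\<sim>\<^bsub>A\<^esub> x)" "\<sim>\<^bsub>A\<^esub> x \<in> S"
    using assms by (auto simp: mv_hom_def mv_subalgebra_def subset_iff)
  then show "\<sim>\<^bsub>B\<^esub> u \<in> f ` S" by blast
  fix v assume "v \<in> f ` S"
  then obtain y where y: "y \<in> S" "v = f y" by blast
  then have "u \<oplus>\<^bsub>B\<^esub> v = f (x \<oplus>\<^bsub>A\<^esub> y)" "x \<oplus>\<^bsub>A\<^esub> y \<in> S"
    using assms x by (auto simp: mv_hom_def mv_subalgebra_def subset_iff)
  then show "u \<oplus>\<^bsub>B\<^esub> v \<in> f ` S" by blast
qed

text \<open>Finitely many generators have finitely many chosen preimages; these lie in a finite
  subalgebra of \<open>A\<close>, whose image is again a finite subalgebra.\<close>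

lemma locally_finite_image:
  assumes "mv_algebra A" "locally_finite A" "mv_hom A B f" "f ` carrier A = carrier B"
  shows "locally_finite B"
proof (rule locally_finiteI)
  fix X assume "X \<subseteq> carrier B" "finite X"
  then obtain Y where Y: "Y \<subseteq> carrier A" "finite Y" "X = f ` Y"
    using assms(4) finite_subset_image by metis
  obtain S where "finite S" "mv_subalgebra S A" "Y \<subseteq> S"
    using locally_finiteE[OF assms(2,1) Y(1,2)] .
  then show "\<exists>B'. finite B' \<and> mv_subalgebra B' B \<and> X \<subseteq> B'"
    using Y mv_subalgebra_image[OF assms(3)] by (intro exI[of _ "f ` S"]) auto
qed


section \<open>Images, subalgebras and products\<close>

text \<open>Operations are evaluated on chosen preimages. The choice is harmless when the fibres of
  \<open>e\<close> form a congruence, which is what \<open>mv_congruence\<close> assumes.\<close>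

definition mv_image :: "'a mv_alg \<Rightarrow> ('a \<Rightarrow> 'b) \<Rightarrow> 'b mv_alg" where
  "mv_image A e =
    \<lparr>carrier = e ` carrier A,
     mv_plus = (\<lambda>u v. e (inv_into (carrier A) e u \<oplus>\<^bsub>A\<^esub> inv_into (carrier A) e v)),
     mv_neg = (\<lambda>u. e (\<sim>\<^bsub>A\<^esub> (inv_into (carrier A) e u))),
     mv_zero = e \<zero>\<^bsub>A\<^esub>\<rparr>"

text \<open>Covers both quotients and transport along injections.\<close>

locale mv_congruence = mv_algebra +
  fixes e :: "'a \<Rightarrow> 'b"
  assumes cong_neg: "\<lbrakk>x \<in> carrier A; x' \<in> carrier A; e x = e x'\<rbrakk> \<Longrightarrow> e (\<sim> x) = e (\<sim> x')"
    and cong_plus: "\<lbrakk>x \<in> carrier A; x' \<in> carrier A; y \<in> carrier A; y' \<in> carrier A; e x = e x'; e y = e y'\<rbrakk>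
      \<Longrightarrow> e (x \<oplus> y) = e (x' \<oplus> y')"
begin

lemma carrier_image: "carrier (mv_image A e) = e ` carrier A"
  by (simp add: mv_image_def)

lemma hom_image: "mv_hom A (mv_image A e) e"
  unfolding mv_hom_def mv_image_def
  by (auto intro!: cong_neg cong_plus simp: inv_into_into f_inv_into_f)

lemma image_ops:
  "\<zero>\<^bsub>mv_image A e\<^esub> = e \<zero>"
  "x \<in> carrier A \<Longrightarrow> \<sim>\<^bsub>mv_image A e\<^esub> (e x) = e (\<sim> x)"
  "x \<in> carrier A \<Longrightarrow> y \<in> carrier A \<Longrightarrow> e x \<oplus>\<^bsub>mv_image A e\<^esub> e y = e (x \<oplus> y)"
  using hom_image by (auto simp: mv_hom_def)

lemma mv_algebra_image: "mv_algebra (mv_image A e)"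
  by (rule mv_algebraI; unfold carrier_image; (elim imageE)?)
    (auto simp: image_ops plus_assoc intro: arg_cong[OF Lukasiewicz, of _ _ e] arg_cong[OF plus_comm, of _ _ e])

lemma locally_finite_mv_image: "locally_finite A \<Longrightarrow> locally_finite (mv_image A e)"
  using locally_finite_image[OF mv_algebra_axioms _ hom_image] by (simp add: carrier_image)

end

section \<open>Products, subalgebras and their copies in the universe\<close>

definition mv_prod :: "'i set \<Rightarrow> ('i \<Rightarrow> 'a mv_alg) \<Rightarrow> ('i \<Rightarrow> 'a) mv_alg" where
  "mv_prod I F =
    \<lparr>carrier = (\<Pi>\<^sub>E i \<in> I. carrier (F i)),
     mv_plus = (\<lambda>x y. \<lambda>i \<in> I. x i \<oplus>\<^bsub>F i\<^esub> y i),
     mv_neg = (\<lambda>x. \<lambda>i \<in> I. \<sim>\<^bsub>F i\<^esub> x i),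
     mv_zero = (\<lambda>i \<in> I. \<zero>\<^bsub>F i\<^esub>)\<rparr>"

lemma carrier_mv_prod: "carrier (mv_prod I F) = (\<Pi>\<^sub>E i \<in> I. carrier (F i))"
  by (simp add: mv_prod_def)

lemma mv_prod_apply [simp]:
  assumes "i \<in> I"
  shows "(x \<oplus>\<^bsub>mv_prod I F\<^esub> y) i = x i \<oplus>\<^bsub>F i\<^esub> y i" "(\<sim>\<^bsub>mv_prod I F\<^esub> x) i = \<sim>\<^bsub>F i\<^esub> x i"
    "\<zero>\<^bsub>mv_prod I F\<^esub> i = \<zero>\<^bsub>F i\<^esub>"
  using assms by (auto simp: mv_prod_def)

lemma mv_algebra_prod:
  assumes "\<And>i. i \<in> I \<Longrightarrow> mv_algebra (F i)"
  shows "mv_algebra (mv_prod I F)"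
proof -
  note F = assms[THEN mv_algebra.zero_closed] assms[THEN mv_algebra.plus_closed]
    assms[THEN mv_algebra.neg_closed] assms[THEN mv_algebra.plus_assoc]
    assms[THEN mv_algebra.zero_plus] assms[THEN mv_algebra.neg_neg]
    assms[THEN mv_algebra.neg_zero_plus]
  show ?thesis
    by (rule mv_algebraI)
      (auto simp: mv_prod_def F PiE_mem fun_eq_iff PiE_iff extensional_def
         intro: assms[THEN mv_algebra.plus_comm] assms[THEN mv_algebra.Lukasiewicz])
qed

lemma mv_algebra_subalgebra:
  assumes "mv_algebra A" "mv_subalgebra B A"
  shows "mv_algebra (A\<lparr>carrier := B\<rparr>)"
proof -
  interpret mv_algebra A by fact
  have B: "x \<in> carrier A" if "x \<in> B" for x
    using assms(2) that by (auto simp: mv_subalgebra_def)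
  show ?thesis
    by (rule mv_algebraI)
      (use assms(2) in \<open>auto simp: mv_subalgebra_def B plus_assoc
         intro: plus_comm[OF B B] Lukasiewicz[OF B B]\<close>)
qed

lemma mv_subalgebra_PiE:
  assumes "\<And>i. i \<in> I \<Longrightarrow> mv_subalgebra (B i) (F i)"
  shows "mv_subalgebra (\<Pi>\<^sub>E i \<in> I. B i) (mv_prod I F)"
  using assms by (auto simp: mv_subalgebra_def mv_prod_def PiE_iff subset_iff)

text \<open>Each coordinate of \<open>X\<close> takes finitely many values and so stays in a finite
  subalgebra \<open>B i\<close>. The box of the \<open>B i\<close> is finite because
  \<open>I\<close> is, and cutting it down to \<open>D\<close> gives a finite subalgebra around
  \<open>X\<close>.\<close>

lemma locally_finite_subproduct:
  assumes "finite I" and F: "\<And>i. i \<in> I \<Longrightarrow> mv_algebra (F i)" "\<And>i. i \<in> I \<Longrightarrow> locally_finite (F i)"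
    and D: "mv_subalgebra D (mv_prod I F)"
  shows "locally_finite ((mv_prod I F)\<lparr>carrier := D\<rparr>)"
proof (rule locally_finiteI)
  fix X assume X: "X \<subseteq> carrier ((mv_prod I F)\<lparr>carrier := D\<rparr>)" "finite X"
  then have XD: "X \<subseteq> D" by simp
  have XF: "X \<subseteq> (\<Pi>\<^sub>E i \<in> I. carrier (F i))"
    using XD D by (auto simp: mv_subalgebra_def carrier_mv_prod)
  have "\<exists>B. finite B \<and> mv_subalgebra B (F i) \<and> (\<lambda>x. x i) ` X \<subseteq> B" if "i \<in> I" for i
  proof -
    have "(\<lambda>x. x i) ` X \<subseteq> carrier (F i)"
      using XF that by auto
    then show ?thesis
      using locally_finiteE[OF F(2,1)[OF that]] X(2) by (metis finite_imageI)
  qed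
  then obtain B where B: "\<And>i. i \<in> I \<Longrightarrow> finite (B i)" "\<And>i. i \<in> I \<Longrightarrow> mv_subalgebra (B i) (F i)"
    "\<And>i. i \<in> I \<Longrightarrow> (\<lambda>x. x i) ` X \<subseteq> B i"
    by metis
  have "finite (\<Pi>\<^sub>E i \<in> I. B i)"
    using assms(1) B(1) by (rule finite_PiE)
  moreover have "mv_subalgebra ((\<Pi>\<^sub>E i \<in> I. B i) \<inter> D) ((mv_prod I F)\<lparr>carrier := D\<rparr>)"
    using mv_subalgebra_PiE[of I B F, OF B(2)] D by (simp add: mv_subalgebra_def le_infI2)
  moreover have "X \<subseteq> (\<Pi>\<^sub>E i \<in> I. B i) \<inter> D"
    using XD XF B(3) by (fastforce simp: PiE_iff)
  ultimately show "\<exists>B. finite B \<and> mv_subalgebra B ((mv_prod I F)\<lparr>carrier := D\<rparr>) \<and> X \<subseteq> B"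
    by blast
qed

text \<open>Coordinates are absorbed one at a time through an injection of
  \<open>'a \<times> 'a\<close> into \<open>'a\<close>. Extensionality fixes the values outside
  \<open>I\<close>, so tuples are determined by their coordinates.\<close>

lemma inj_on_extensional_ex:
  assumes inf: "infinite (UNIV :: 'a set)" and "finite I"
  shows "\<exists>e :: ('i \<Rightarrow> 'a) \<Rightarrow> 'a. inj_on e (extensional I)"
  using assms(2)
proof (induction I rule: finite_induct)
  case empty
  \<comment> \<open>Only one function is extensional on the empty set, so any constant map will
    do.\<close>
  have "inj_on (\<lambda>x. undefined) (extensional {} :: ('i \<Rightarrow> 'a) set)"
    by (simp add: inj_on_def)
  then show ?case by blast
next
  case (insert i I)
  then obtain e :: "('i \<Rightarrow> 'a) \<Rightarrow> 'a" where e: "inj_on e (extensional I)" by blast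
  \<comment> \<open>Cardinal arithmetic: an infinite type is equinumerous with its square.\<close>
  obtain p :: "'a \<times> 'a \<Rightarrow> 'a" where p: "inj p"
    using card_of_Times_same_infinite[OF inf] card_of_ordIso[of "UNIV \<times> UNIV :: ('a \<times> 'a) set" "UNIV :: 'a set"]
    by (auto simp: bij_betw_def)
  have "inj_on (\<lambda>x. p (x i, e (restrict x I))) (extensional (insert i I))"
  proof (rule inj_onI)
    fix x y :: "'i \<Rightarrow> 'a"
    assume xy: "x \<in> extensional (insert i I)" "y \<in> extensional (insert i I)"
      and "p (x i, e (restrict x I)) = p (y i, e (restrict y I))"
    then have "x i = y i" "restrict x I = restrict y I"
      using p e by (auto simp: inj_eq inj_on_eq_iff)
    then show "x = y"
      using xy by (intro extensionalityI[OF xy]) (metis insertE restrict_apply')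
  qed
  then show ?case by blast
qed

text \<open>A subalgebra of a product has elements of type \<open>'i \<Rightarrow> 'a\<close> and so
  is no object of \<open>MV_lf\<close>. This provides an isomorphic copy over \<open>'a\<close>,
  described only by its projections: they are jointly injective and their tuples are exactly the
  members of \<open>D\<close>.\<close>

lemma subproduct_representable:
  fixes F :: "'i \<Rightarrow> 'a mv_alg"
  assumes inf: "infinite (UNIV :: 'a set)" and "finite I"
    and F: "\<And>i. i \<in> I \<Longrightarrow> mv_algebra (F i)" "\<And>i. i \<in> I \<Longrightarrow> locally_finite (F i)"
    and D: "mv_subalgebra D (mv_prod I F)"
  obtains L :: "'a mv_alg" and \<pi> where "mv_algebra L" "locally_finite L"
    "\<And>i. i \<in> I \<Longrightarrow> mv_hom L (F i) (\<pi> i)"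
    "\<And>x y. x \<in> carrier L \<Longrightarrow> y \<in> carrier L \<Longrightarrow> \<forall>i \<in> I. \<pi> i x = \<pi> i y \<Longrightarrow> x = y"
    "\<And>x. x \<in> carrier L \<Longrightarrow> (\<lambda>i \<in> I. \<pi> i x) \<in> D"
    "\<And>d. d \<in> D \<Longrightarrow> \<exists>x \<in> carrier L. \<forall>i \<in> I. \<pi> i x = d i"
proof -
  let ?B = "(mv_prod I F)\<lparr>carrier := D\<rparr>"
  obtain e :: "('i \<Rightarrow> 'a) \<Rightarrow> 'a" where e: "inj_on e (extensional I)"
    using inj_on_extensional_ex[OF inf \<open>finite I\<close>] by blast
  have DP: "D \<subseteq> (\<Pi>\<^sub>E i \<in> I. carrier (F i))"
    using D by (simp add: mv_subalgebra_def carrier_mv_prod)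
  have Dext: "d \<in> extensional I" if "d \<in> D" for d
    using that DP by (auto simp: PiE_def)
  have DF: "d i \<in> carrier (F i)" if "d \<in> D" "i \<in> I" for d i
    using that DP by auto
  have eD: "inj_on e D"
    using e by (rule inj_on_subset) (use Dext in blast)
  \<comment> \<open>Injectivity of \<open>e\<close> makes the fibres trivial, so the congruence
    conditions are immediate.\<close>
  interpret B: mv_congruence ?B e
    unfolding mv_congruence_def mv_congruence_axioms_def
    using mv_algebra_subalgebra[OF mv_algebra_prod[OF F(1)] D] inj_onD[OF eD] by auto
  let ?L = "mv_image ?B e"
  \<comment> \<open>\<open>s\<close> decodes an element of the copy into its tuple; the projections
    are the coordinates of that tuple.\<close>
  define s where "s = inv_into D e"
  have s: "s (e d) = d" if "d \<in> D" for d
    using that eD by (simp add: s_def)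
  have L: "carrier ?L = e ` D"
    using B.carrier_image by simp
  show thesis
  proof (rule that[of ?L "\<lambda>i x. s x i"])
    show "mv_algebra ?L" by (rule B.mv_algebra_image)
    show "locally_finite ?L"
      using locally_finite_subproduct[OF \<open>finite I\<close> F D] by (rule B.locally_finite_mv_image)
  next
    fix i assume "i \<in> I"
    then show "mv_hom ?L (F i) (\<lambda>x. s x i)"
      unfolding mv_hom_def L
      using B.image_ops D by (auto simp: s DF mv_subalgebra_def)
  next
    fix x y assume "x \<in> carrier ?L" "y \<in> carrier ?L" "\<forall>i \<in> I. s x i = s y i"
    then show "x = y"
      unfolding L by (metis Dext s extensionalityI imageE)
  next
    fix x assume "x \<in> carrier ?L"
    then show "(\<lambda>i \<in> I. s x i) \<in> D"
      unfolding L using Dext by (auto simp: s extensional_restrict)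
  next
    fix d assume "d \<in> D"
    then show "\<exists>x \<in> carrier ?L. \<forall>i \<in> I. s x i = d i"
      unfolding L by (auto simp: s)
  qed
qed


section \<open>The category of locally finite MV-algebras\<close>

lemma MV_lf_simps [simp]: "Dom MV_lf = src" "Cod MV_lf = tgt"
  by (simp_all add: MV_lf_def)

lemma Ob_MV_lf: "A \<in> Ob MV_lf \<longleftrightarrow> mv_algebra A \<and> locally_finite A"
  by (simp add: MV_lf_def)

lemma Hom_MV_lf:
  "f \<in> Hom MV_lf A B \<longleftrightarrow> A \<in> Ob MV_lf \<and> B \<in> Ob MV_lf \<and> src f = A \<and> tgt f = B \<and>
     mv_hom A B (map_of_arrow f) \<and> map_of_arrow f \<in> extensional (carrier A)"
  by (auto simp: Hom_def MV_lf_def)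

lemma Hom_MV_lfD:
  assumes "f \<in> Hom MV_lf A B"
  shows "A \<in> Ob MV_lf" "B \<in> Ob MV_lf" "mv_algebra A" "mv_algebra B" "src f = A" "tgt f = B"
    "mv_hom A B (map_of_arrow f)" "x \<in> carrier A \<Longrightarrow> map_of_arrow f x \<in> carrier B" "f \<in> Ar MV_lf"
proof -
  show "f \<in> Ar MV_lf"
    using assms by (simp add: Hom_def)
qed (use assms in \<open>auto simp: Hom_MV_lf Ob_MV_lf mv_hom_closed\<close>)

lemma Hom_MV_lf_eqI:
  assumes "f \<in> Hom MV_lf A B" "g \<in> Hom MV_lf A B"
    "\<And>x. x \<in> carrier A \<Longrightarrow> map_of_arrow f x = map_of_arrow g x"
  shows "f = g"
  using assms by (intro mv_arrow.equality) (auto simp: Hom_MV_lf intro: extensionalityI)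

text \<open>Restriction supplies the extensionality demanded of arrows, so any representing function
  may be used.\<close>

definition mv_arr :: "'a mv_alg \<Rightarrow> 'a mv_alg \<Rightarrow> ('a \<Rightarrow> 'a) \<Rightarrow> 'a mv_arrow" where
  "mv_arr A B h = \<lparr>src = A, tgt = B, map_of_arrow = restrict h (carrier A)\<rparr>"

lemma mv_arr_Hom:
  "A \<in> Ob MV_lf \<Longrightarrow> B \<in> Ob MV_lf \<Longrightarrow> mv_hom A B h \<Longrightarrow> mv_arr A B h \<in> Hom MV_lf A B"
  by (simp add: mv_arr_def Hom_MV_lf Ob_MV_lf)

lemma mv_arr_apply [simp]: "x \<in> carrier A \<Longrightarrow> map_of_arrow (mv_arr A B h) x = h x"
  by (simp add: mv_arr_def)

lemma Id_MV_lf: "Id MV_lf A = mv_arr A A (\<lambda>x. x)"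
  by (simp add: MV_lf_def mv_arr_def id_def)

lemma Comp_MV_lf:
  "g \<cdot>\<^bsub>MV_lf\<^esub> f = mv_arr (src f) (tgt g) (\<lambda>x. map_of_arrow g (map_of_arrow f x))"
  by (simp add: MV_lf_def mv_arr_def compose_def)

lemma Comp_MV_lf_Hom:
  "f \<in> Hom MV_lf A B \<Longrightarrow> g \<in> Hom MV_lf B D \<Longrightarrow> g \<cdot>\<^bsub>MV_lf\<^esub> f \<in> Hom MV_lf A D"
  unfolding Comp_MV_lf by (auto simp: Hom_MV_lfD intro!: mv_arr_Hom mv_hom_compose[OF Hom_MV_lfD(7) Hom_MV_lfD(7)])

lemma Comp_MV_lf_apply [simp]:
  "f \<in> Hom MV_lf A B \<Longrightarrow> x \<in> carrier A \<Longrightarrow>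
     map_of_arrow (g \<cdot>\<^bsub>MV_lf\<^esub> f) x = map_of_arrow g (map_of_arrow f x)"
  by (simp add: Comp_MV_lf Hom_MV_lfD)

text \<open>Commuting triangles become pointwise equations, which is how the diagrams below are
  checked.\<close>

lemma Comp_MV_lf_eq_iff:
  assumes "f \<in> Hom MV_lf A B" "g \<in> Hom MV_lf B D" "k \<in> Hom MV_lf A D"
  shows "g \<cdot>\<^bsub>MV_lf\<^esub> f = k \<longleftrightarrow>
    (\<forall>x \<in> carrier A. map_of_arrow g (map_of_arrow f x) = map_of_arrow k x)"
  using assms Comp_MV_lf_apply[OF assms(1)] Hom_MV_lf_eqI[OF Comp_MV_lf_Hom[OF assms(1,2)] assms(3)]
  by metis

lemma Id_MV_lf_Hom: "A \<in> Ob MV_lf \<Longrightarrow> Id MV_lf A \<in> Hom MV_lf A A"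
  unfolding Id_MV_lf by (rule mv_arr_Hom) (auto simp: mv_hom_def)

lemma category_MV_lf: "category MV_lf"
proof
  fix f :: "'a mv_arrow" assume "f \<in> Ar MV_lf"
  then have "f \<in> Hom MV_lf (src f) (tgt f)"
    by (simp add: Hom_def)
  then show "Dom MV_lf f \<in> Ob MV_lf" "Cod MV_lf f \<in> Ob MV_lf"
    using Hom_MV_lfD(1,2) by auto
next
  fix A :: "'a mv_alg" assume "A \<in> Ob MV_lf"
  then show "Id MV_lf A \<in> Hom MV_lf A A" by (rule Id_MV_lf_Hom)
next
  fix f g :: "'a mv_arrow" and A B D
  assume "f \<in> Hom MV_lf A B" "g \<in> Hom MV_lf B D"
  then show "g \<cdot>\<^bsub>MV_lf\<^esub> f \<in> Hom MV_lf A D" by (rule Comp_MV_lf_Hom)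
next
  fix f :: "'a mv_arrow" and A B
  assume f: "f \<in> Hom MV_lf A B"
  note Id = Id_MV_lf_Hom[OF Hom_MV_lfD(1)[OF f]] Id_MV_lf_Hom[OF Hom_MV_lfD(2)[OF f]]
  show "f \<cdot>\<^bsub>MV_lf\<^esub> Id MV_lf A = f"
    using f Id by (simp add: Comp_MV_lf_eq_iff) (simp add: Id_MV_lf)
  show "Id MV_lf B \<cdot>\<^bsub>MV_lf\<^esub> f = f"
    using f Id by (simp add: Comp_MV_lf_eq_iff) (simp add: Id_MV_lf Hom_MV_lfD)
next
  fix f g h :: "'a mv_arrow" and A B D E
  assume fgh: "f \<in> Hom MV_lf A B" "g \<in> Hom MV_lf B D" "h \<in> Hom MV_lf D E"
  note gf = Comp_MV_lf_Hom[OF fgh(1,2)] and hg = Comp_MV_lf_Hom[OF fgh(2,3)]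
  show "(h \<cdot>\<^bsub>MV_lf\<^esub> g) \<cdot>\<^bsub>MV_lf\<^esub> f = h \<cdot>\<^bsub>MV_lf\<^esub> (g \<cdot>\<^bsub>MV_lf\<^esub> f)"
    by (rule Hom_MV_lf_eqI[OF Comp_MV_lf_Hom[OF fgh(1) hg] Comp_MV_lf_Hom[OF gf fgh(3)]])
      (simp add: Comp_MV_lf_apply[OF fgh(1)] Comp_MV_lf_apply[OF fgh(2)]
        Comp_MV_lf_apply[OF gf] Hom_MV_lfD(8)[OF fgh(1)])
qed

text \<open>The limit is the algebra of compatible families inside the product over all objects of
  \<open>J\<close>, moved into the universe by \<open>subproduct_representable\<close>.\<close>

lemma has_finite_limits_MV_lf:
  assumes inf: "infinite (UNIV :: 'a set)"
  shows "has_finite_limits (MV_lf :: ('a mv_alg, 'a mv_arrow) cat)"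
  unfolding has_finite_limits_def
proof (intro allI impI, elim conjE)
  fix J :: "(nat, nat) cat" and Fo and Fa :: "nat \<Rightarrow> 'a mv_arrow"
  assume fin: "finite (Ob J)" and "functor_between J MV_lf Fo Fa"
  then interpret functor_between J MV_lf Fo Fa by simp
  have Fo: "mv_algebra (Fo i)" "locally_finite (Fo i)" if "i \<in> Ob J" for i
    using map_Ob[OF that] by (auto simp: Ob_MV_lf)
  define D where "D = {x \<in> \<Pi>\<^sub>E i \<in> Ob J. carrier (Fo i).
    \<forall>i \<in> Ob J. \<forall>j \<in> Ob J. \<forall>u \<in> Hom J i j. map_of_arrow (Fa u) (x i) = x j}"
  note Fa = Hom_MV_lfD(7)[OF map_Hom, unfolded mv_hom_def]
  \<comment> \<open>Compatibility survives the operations because every \<open>Fa u\<close> is a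
    homomorphism.\<close>
  have D: "mv_subalgebra D (mv_prod (Ob J) Fo)"
    unfolding mv_subalgebra_def
  proof (intro conjI ballI)
    note P = mv_algebra_prod[of "Ob J" Fo, OF Fo(1)]
    show "D \<subseteq> carrier (mv_prod (Ob J) Fo)"
      by (auto simp: D_def carrier_mv_prod)
    show "\<zero>\<^bsub>mv_prod (Ob J) Fo\<^esub> \<in> D"
      unfolding D_def
      using mv_algebra.zero_closed[OF P, unfolded carrier_mv_prod] Fa by simp
    fix x assume x: "x \<in> D"
    then have xP: "x \<in> carrier (mv_prod (Ob J) Fo)"
      by (simp add: D_def carrier_mv_prod)
    then have xF: "x i \<in> carrier (Fo i)" if "i \<in> Ob J" for i
      using that by (auto simp: carrier_mv_prod)
    show "\<sim>\<^bsub>mv_prod (Ob J) Fo\<^esub> x \<in> D"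
      unfolding D_def
      using mv_algebra.neg_closed[OF P xP, unfolded carrier_mv_prod] Fa xF x by (simp add: D_def)
    fix y assume y: "y \<in> D"
    then have yP: "y \<in> carrier (mv_prod (Ob J) Fo)"
      by (simp add: D_def carrier_mv_prod)
    then have yF: "y i \<in> carrier (Fo i)" if "i \<in> Ob J" for i
      using that by (auto simp: carrier_mv_prod)
    show "x \<oplus>\<^bsub>mv_prod (Ob J) Fo\<^esub> y \<in> D"
      unfolding D_def
      using mv_algebra.plus_closed[OF P xP yP, unfolded carrier_mv_prod] Fa xF yF x y
      by (simp add: D_def)
  qed
  obtain L :: "'a mv_alg" and \<pi> where L: "mv_algebra L" "locally_finite L"
    and \<pi>: "\<And>i. i \<in> Ob J \<Longrightarrow> mv_hom L (Fo i) (\<pi> i)"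
    and "\<And>x y. x \<in> carrier L \<Longrightarrow> y \<in> carrier L \<Longrightarrow> \<forall>i \<in> Ob J. \<pi> i x = \<pi> i y \<Longrightarrow> x = y"
    and LD: "\<And>x. x \<in> carrier L \<Longrightarrow> (\<lambda>i \<in> Ob J. \<pi> i x) \<in> D"
    and DL: "\<And>d. d \<in> D \<Longrightarrow> \<exists>x \<in> carrier L. \<forall>i \<in> Ob J. \<pi> i x = d i"
    by (rule subproduct_representable[OF inf fin Fo D]) (assumption | rule that)+
  then have inj: "x = y"
    if "x \<in> carrier L" "y \<in> carrier L" "\<And>i. i \<in> Ob J \<Longrightarrow> \<pi> i x = \<pi> i y" for x y
    using that by blast
  have LOb: "L \<in> Ob MV_lf"
    using L by (simp add: Ob_MV_lf)
  define p where "p i = mv_arr L (Fo i) (\<pi> i)" for i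
  have p: "p i \<in> Hom MV_lf L (Fo i)" if "i \<in> Ob J" for i
    unfolding p_def using that LOb map_Ob \<pi> by (intro mv_arr_Hom)
  have p_apply: "map_of_arrow (p i) x = \<pi> i x" if "x \<in> carrier L" for i x
    using that by (simp add: p_def)
  have "is_cone J MV_lf Fo Fa L p"
    unfolding is_cone_def
  proof (intro conjI ballI)
    fix i j u assume iju: "i \<in> Ob J" "j \<in> Ob J" "u \<in> Hom J i j"
    show "Fa u \<cdot>\<^bsub>MV_lf\<^esub> p i = p j"
      unfolding Comp_MV_lf_eq_iff[OF p[OF iju(1)] map_Hom[OF iju(3)] p[OF iju(2)]]
      using LD iju by (auto simp: p_apply D_def)
  qed (use LOb p in auto)
  moreover have "\<exists>!h. h \<in> Hom MV_lf M L \<and> (\<forall>i \<in> Ob J. p i \<cdot>\<^bsub>MV_lf\<^esub> h = \<mu> i)"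
    if "is_cone J MV_lf Fo Fa M \<mu>" for M \<mu>
  proof -
    have MOb: "M \<in> Ob MV_lf" and \<mu>: "\<And>i. i \<in> Ob J \<Longrightarrow> \<mu> i \<in> Hom MV_lf M (Fo i)"
      and cone: "\<And>i j u. i \<in> Ob J \<Longrightarrow> j \<in> Ob J \<Longrightarrow> u \<in> Hom J i j \<Longrightarrow> Fa u \<cdot>\<^bsub>MV_lf\<^esub> \<mu> i = \<mu> j"
      using that by (auto simp: is_cone_def)
    \<comment> \<open>At each point \<open>m\<close> the legs of the cone form a compatible family,
      hence an element of \<open>L\<close>.\<close>
    have ex: "\<exists>x \<in> carrier L. \<forall>i \<in> Ob J. \<pi> i x = map_of_arrow (\<mu> i) m" if m: "m \<in> carrier M" for m
    proof -
      have "map_of_arrow (Fa u) (map_of_arrow (\<mu> i) m) = map_of_arrow (\<mu> j) m"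
        if "i \<in> Ob J" "j \<in> Ob J" "u \<in> Hom J i j" for i j u
        using cone[OF that] Comp_MV_lf_apply[OF \<mu>[OF that(1)] m] by metis
      then have "(\<lambda>i \<in> Ob J. map_of_arrow (\<mu> i) m) \<in> D"
        using Hom_MV_lfD(8)[OF \<mu> m] by (auto simp: D_def)
      from DL[OF this] show ?thesis by simp
    qed
    obtain h where h: "mv_hom M L h"
      "\<And>i m. i \<in> Ob J \<Longrightarrow> m \<in> carrier M \<Longrightarrow> \<pi> i (h m) = map_of_arrow (\<mu> i) m"
    proof (rule mv_hom_factor[where I = "Ob J" and F = Fo and \<pi> = \<pi> and M = M and L = L
          and \<mu> = "\<lambda>i. map_of_arrow (\<mu> i)"])
      show "mv_algebra M"
        using MOb by (simp add: Ob_MV_lf)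
      show "x = y" if "x \<in> carrier L" "y \<in> carrier L" "\<And>i. i \<in> Ob J \<Longrightarrow> \<pi> i x = \<pi> i y" for x y
        using that by (rule inj)
    qed (use L \<pi> Hom_MV_lfD(7)[OF \<mu>] ex in auto)
    show ?thesis
    proof (intro ex1I[of _ "mv_arr M L h"] conjI ballI)
      show H: "mv_arr M L h \<in> Hom MV_lf M L"
        using MOb LOb h(1) by (rule mv_arr_Hom)
      show "p i \<cdot>\<^bsub>MV_lf\<^esub> mv_arr M L h = \<mu> i" if "i \<in> Ob J" for i
        unfolding Comp_MV_lf_eq_iff[OF H p[OF that] \<mu>[OF that]]
        using h(2)[OF that] mv_hom_closed[OF h(1)] by (simp add: p_apply)
      fix k assume k: "k \<in> Hom MV_lf M L \<and> (\<forall>i \<in> Ob J. p i \<cdot>\<^bsub>MV_lf\<^esub> k = \<mu> i)"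
      then have kH: "k \<in> Hom MV_lf M L" by blast
      show "k = mv_arr M L h"
      \<comment> \<open>Uniqueness: both candidates have the same projections at \<open>m\<close>,
        and the projections are jointly injective.\<close>
      proof (rule Hom_MV_lf_eqI[OF kH H])
        fix m assume m: "m \<in> carrier M"
        show "map_of_arrow k m = map_of_arrow (mv_arr M L h) m"
        proof (rule inj)
          fix i assume i: "i \<in> Ob J"
          then have "map_of_arrow (p i) (map_of_arrow k m) = map_of_arrow (\<mu> i) m"
            using k Comp_MV_lf_eq_iff[OF kH p[OF i] \<mu>[OF i]] m by blast
          then show "\<pi> i (map_of_arrow k m) = \<pi> i (map_of_arrow (mv_arr M L h) m)"
            using m h(2)[OF i m] Hom_MV_lfD(8)[OF kH m] by (simp add: p_apply)
        qed (use m Hom_MV_lfD(8)[OF kH m] mv_hom_closed[OF h(1) m] in auto)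
      qed
    qed
  qed
  ultimately show "\<exists>L \<pi>. is_limit J MV_lf Fo Fa L \<pi>"
    unfolding is_limit_def by blast
qed


section \<open>Reflexive relations\<close>

lemma pairing_iff:
  assumes "is_product C A B P q0 q1" "f \<in> Hom C X A" "g \<in> Hom C X B"
  shows "h = pairing C P q0 q1 f g \<longleftrightarrow> h \<in> Hom C X P \<and> q0 \<cdot>\<^bsub>C\<^esub> h = f \<and> q1 \<cdot>\<^bsub>C\<^esub> h = g"
proof -
  have ex1: "\<exists>!h. h \<in> Hom C X P \<and> q0 \<cdot>\<^bsub>C\<^esub> h = f \<and> q1 \<cdot>\<^bsub>C\<^esub> h = g"
    using assms unfolding is_product_def by blast
  have "Dom C f = X"
    using assms(2) by (simp add: Hom_def)
  then have eq: "pairing C P q0 q1 f g = (THE h. h \<in> Hom C X P \<and> q0 \<cdot>\<^bsub>C\<^esub> h = f \<and> q1 \<cdot>\<^bsub>C\<^esub> h = g)"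
    by (simp add: pairing_def)
  show ?thesis
    unfolding eq
  proof
    assume "h = (THE h. h \<in> Hom C X P \<and> q0 \<cdot>\<^bsub>C\<^esub> h = f \<and> q1 \<cdot>\<^bsub>C\<^esub> h = g)"
    then show "h \<in> Hom C X P \<and> q0 \<cdot>\<^bsub>C\<^esub> h = f \<and> q1 \<cdot>\<^bsub>C\<^esub> h = g"
      using theI'[OF ex1] by (simp only:)
  qed (rule the1_equality[OF ex1, symmetric])
qed

text \<open>An arrow into the product is determined by its two components; by associativity those of
  the composite are \<open>p0\<close> and \<open>p1\<close> followed back along
  \<open>h\<close>.\<close>

lemma pairing_comp_eq_iff:
  assumes "category C" "is_product C A A P q0 q1" "p0 \<in> Hom C R A" "p1 \<in> Hom C R A"
    "f \<in> Hom C X A" "g \<in> Hom C X A" "h \<in> Hom C X R"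
  shows "pairing C P q0 q1 p0 p1 \<cdot>\<^bsub>C\<^esub> h = pairing C P q0 q1 f g \<longleftrightarrow> p0 \<cdot>\<^bsub>C\<^esub> h = f \<and> p1 \<cdot>\<^bsub>C\<^esub> h = g"
proof -
  interpret category C by fact
  define m where "m = pairing C P q0 q1 p0 p1"
  have m: "m \<in> Hom C R P" "q0 \<cdot>\<^bsub>C\<^esub> m = p0" "q1 \<cdot>\<^bsub>C\<^esub> m = p1"
    using pairing_iff[OF assms(2-4)] m_def by blast+
  have q: "q0 \<in> Hom C P A" "q1 \<in> Hom C P A"
    using assms(2) by (auto simp: is_product_def)
  have "q0 \<cdot>\<^bsub>C\<^esub> (m \<cdot>\<^bsub>C\<^esub> h) = p0 \<cdot>\<^bsub>C\<^esub> h" "q1 \<cdot>\<^bsub>C\<^esub> (m \<cdot>\<^bsub>C\<^esub> h) = p1 \<cdot>\<^bsub>C\<^esub> h"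
    using Comp_assoc[OF assms(7) m(1) q(1)] Comp_assoc[OF assms(7) m(1) q(2)] m by simp_all
  then show ?thesis
    using pairing_iff[OF assms(2,5,6), of "m \<cdot>\<^bsub>C\<^esub> h"] Comp_Hom[OF assms(7) m(1)]
    by (simp add: m_def)
qed

text \<open>This removes the chosen product \<open>(P, q0, q1)\<close>: factoring through the
  relation becomes a condition on \<open>p0\<close> and \<open>p1\<close> alone.\<close>

lemma factors_through_pairing_iff:
  assumes "category C" "is_product C A A P q0 q1" "p0 \<in> Hom C R A" "p1 \<in> Hom C R A"
    "f \<in> Hom C X A" "g \<in> Hom C X A"
  shows "factors_through C (pairing C P q0 q1 f g) (pairing C P q0 q1 p0 p1) \<longleftrightarrow>
    (\<exists>h \<in> Hom C X R. p0 \<cdot>\<^bsub>C\<^esub> h = f \<and> p1 \<cdot>\<^bsub>C\<^esub> h = g)"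
proof -
  have "Dom C (pairing C P q0 q1 f g) = X" "Dom C (pairing C P q0 q1 p0 p1) = R"
    using pairing_iff[OF assms(2,5,6)] pairing_iff[OF assms(2-4)] unfolding Hom_def by blast+
  then show ?thesis
    unfolding factors_through_def using pairing_comp_eq_iff[OF assms] by metis
qed

lemma monic_pairingD:
  assumes "category C" "is_product C A A P q0 q1" "p0 \<in> Hom C R A" "p1 \<in> Hom C R A"
    "monic C (pairing C P q0 q1 p0 p1)" "f \<in> Hom C X R" "g \<in> Hom C X R"
    "p0 \<cdot>\<^bsub>C\<^esub> f = p0 \<cdot>\<^bsub>C\<^esub> g" "p1 \<cdot>\<^bsub>C\<^esub> f = p1 \<cdot>\<^bsub>C\<^esub> g"
  shows "f = g"
proof -
  interpret category C by fact
  have g: "p0 \<cdot>\<^bsub>C\<^esub> g \<in> Hom C X A" "p1 \<cdot>\<^bsub>C\<^esub> g \<in> Hom C X A"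
    using assms Comp_Hom by blast+
  have "Dom C (pairing C P q0 q1 p0 p1) = R"
    using pairing_iff[OF assms(2-4)] unfolding Hom_def by blast
  moreover have "pairing C P q0 q1 p0 p1 \<cdot>\<^bsub>C\<^esub> f = pairing C P q0 q1 p0 p1 \<cdot>\<^bsub>C\<^esub> g"
    using pairing_comp_eq_iff[OF assms(1-4) g assms(6)] pairing_comp_eq_iff[OF assms(1-4) g assms(7)]
      assms(8,9) by simp
  ultimately show ?thesis
    using assms(5-7) unfolding monic_def by blast
qed

text \<open>Pairs in \<open>R\<close> with equal images under both maps form a locally finite
  algebra. Its two projections to \<open>R\<close> agree after \<open>p0\<close> and after
  \<open>p1\<close>, so they coincide, and \<open>(r, s)\<close> is one of these pairs.\<close>

lemma jointly_monic_imp_injective: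
  fixes A R :: "'a mv_alg"
  assumes inf: "infinite (UNIV :: 'a set)"
    and p0: "p0 \<in> Hom MV_lf R A" and p1: "p1 \<in> Hom MV_lf R A"
    and monic: "\<And>X f g. f \<in> Hom MV_lf X R \<Longrightarrow> g \<in> Hom MV_lf X R \<Longrightarrow>
      p0 \<cdot>\<^bsub>MV_lf\<^esub> f = p0 \<cdot>\<^bsub>MV_lf\<^esub> g \<Longrightarrow> p1 \<cdot>\<^bsub>MV_lf\<^esub> f = p1 \<cdot>\<^bsub>MV_lf\<^esub> g \<Longrightarrow> f = g"
    and rs: "r \<in> carrier R" "s \<in> carrier R"
      "map_of_arrow p0 r = map_of_arrow p0 s" "map_of_arrow p1 r = map_of_arrow p1 s"
  shows "r = s"
proof -
  have R: "mv_algebra R" "locally_finite R" and ROb: "R \<in> Ob MV_lf"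
    using Hom_MV_lfD(1)[OF p0] by (auto simp: Ob_MV_lf)
  \<comment> \<open>\<open>bool\<close> indexes the two copies of \<open>R\<close>:
    \<open>True\<close> the first coordinate, \<open>False\<close> the second.\<close>
  let ?P = "mv_prod (UNIV :: bool set) (\<lambda>_. R)"
  define D where "D = {x \<in> carrier ?P.
    map_of_arrow p0 (x True) = map_of_arrow p0 (x False) \<and>
    map_of_arrow p1 (x True) = map_of_arrow p1 (x False)}"
  have D: "mv_subalgebra D ?P"
  proof -
    interpret P: mv_algebra ?P by (rule mv_algebra_prod) (rule R)
    have mem: "x i \<in> carrier R" if "x \<in> carrier ?P" for x i
      using that by (auto simp: carrier_mv_prod)
    show ?thesis
      using Hom_MV_lfD(7)[OF p0] Hom_MV_lfD(7)[OF p1]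
      by (auto simp: mv_subalgebra_def D_def mv_hom_def mem)
  qed
  obtain L :: "'a mv_alg" and \<pi> where L: "mv_algebra L" "locally_finite L"
    and \<pi>: "\<And>i. i \<in> UNIV \<Longrightarrow> mv_hom L R (\<pi> i)"
    and LD: "\<And>x. x \<in> carrier L \<Longrightarrow> (\<lambda>i \<in> UNIV. \<pi> i x) \<in> D"
    and DL: "\<And>d. d \<in> D \<Longrightarrow> \<exists>x \<in> carrier L. \<forall>i \<in> UNIV. \<pi> i x = d i"
    by (rule subproduct_representable[OF inf finite R D]) (assumption | rule that)+
  have LOb: "L \<in> Ob MV_lf"
    using L by (simp add: Ob_MV_lf)
  note H = mv_arr_Hom[OF LOb ROb \<pi>[OF UNIV_I]]
  have "p0 \<cdot>\<^bsub>MV_lf\<^esub> mv_arr L R (\<pi> True) = p0 \<cdot>\<^bsub>MV_lf\<^esub> mv_arr L R (\<pi> False)"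
    "p1 \<cdot>\<^bsub>MV_lf\<^esub> mv_arr L R (\<pi> True) = p1 \<cdot>\<^bsub>MV_lf\<^esub> mv_arr L R (\<pi> False)"
    unfolding Comp_MV_lf_eq_iff[OF H p0 Comp_MV_lf_Hom[OF H p0]]
      Comp_MV_lf_eq_iff[OF H p1 Comp_MV_lf_Hom[OF H p1]]
    using LD by (auto simp: Comp_MV_lf_apply[OF H] D_def)
  then have eq: "mv_arr L R (\<pi> True) = mv_arr L R (\<pi> False)"
    using H monic by blast
  \<comment> \<open>The pair \<open>(r, s)\<close> itself; the equality of the projections is
    evaluated at the element representing it.\<close>
  have "(\<lambda>i. if i then r else s) \<in> D"
    using rs by (auto simp: D_def carrier_mv_prod)
  then obtain x where x: "x \<in> carrier L" "\<pi> True x = r" "\<pi> False x = s"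
    using DL by fastforce
  then show ?thesis
    using eq mv_arr_apply by metis
qed

text \<open>The purely algebraic content of an internal reflexive relation: \<open>r\<close> stands
  for the pair \<open>(f0 r, f1 r)\<close>, so \<open>R\<close> is a copy of a subalgebra of the
  square of \<open>A\<close> that contains the diagonal.\<close>

locale mv_reflexive_relation =
  fixes A R :: "'a mv_alg" and f0 f1 :: "'a \<Rightarrow> 'a"
  assumes A: "mv_algebra A" and R: "mv_algebra R"
    and hom0: "mv_hom R A f0" and hom1: "mv_hom R A f1"
    and inj: "r \<in> carrier R \<Longrightarrow> s \<in> carrier R \<Longrightarrow> f0 r = f0 s \<Longrightarrow> f1 r = f1 s \<Longrightarrow> r = s"
    and refl: "a \<in> carrier A \<Longrightarrow> \<exists>r \<in> carrier R. f0 r = a \<and> f1 r = a"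
begin

sublocale A: mv_algebra A by (rule A)

sublocale R: mv_algebra R by (rule R)

definition rel :: "'a \<Rightarrow> 'a \<Rightarrow> bool" where
  "rel a b \<longleftrightarrow> (\<exists>r \<in> carrier R. f0 r = a \<and> f1 r = b)"

lemma relI: "r \<in> carrier R \<Longrightarrow> rel (f0 r) (f1 r)"
  by (auto simp: rel_def)

lemma rel_carrier: "rel a b \<Longrightarrow> a \<in> carrier A \<and> b \<in> carrier A"
  using hom0 hom1 by (auto simp: rel_def mv_hom_closed)

lemma rel_refl: "a \<in> carrier A \<Longrightarrow> rel a a"
  using refl by (simp add: rel_def)

lemma rel_neg: "rel a b \<Longrightarrow> rel (\<sim>\<^bsub>A\<^esub> a) (\<sim>\<^bsub>A\<^esub> b)"
  using hom0 hom1 R.neg_closed unfolding rel_def mv_hom_def by blast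

lemma rel_plus: "rel a b \<Longrightarrow> rel c d \<Longrightarrow> rel (a \<oplus>\<^bsub>A\<^esub> c) (b \<oplus>\<^bsub>A\<^esub> d)"
  using hom0 hom1 R.plus_closed unfolding rel_def mv_hom_def by metis

lemma rel_maltsev:
  "rel a a' \<Longrightarrow> rel b b' \<Longrightarrow> rel c c' \<Longrightarrow> rel (mv_maltsev A a b c) (mv_maltsev A a' b' c')"
  using mv_hom_maltsev[OF R hom0] mv_hom_maltsev[OF R hom1] R.maltsev_closed
  unfolding rel_def by metis

text \<open>Apply the term to the pairs \<open>(a, a)\<close>, \<open>(a, b)\<close>,
  \<open>(b, b)\<close>: the first coordinates give \<open>b\<close>, the second ones
  \<open>a\<close>.\<close>

lemma rel_sym: "rel a b \<Longrightarrow> rel b a"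
  using rel_maltsev[of a a a b b b] rel_carrier[of a b]
  by (simp add: rel_refl A.maltsev_left A.maltsev_right)

text \<open>Apply the term to the pairs \<open>(a, b)\<close>, \<open>(b, b)\<close>,
  \<open>(b, c)\<close>: the first coordinates give \<open>a\<close>, the second ones
  \<open>c\<close>.\<close>

lemma rel_trans: "rel a b \<Longrightarrow> rel b c \<Longrightarrow> rel a c"
  using rel_maltsev[of a b b b b c] rel_carrier[of a b] rel_carrier[of b c]
  by (simp add: rel_refl A.maltsev_left A.maltsev_right)

text \<open>A choice of representatives keeps the quotient within the universe \<open>'a\<close>.\<close>

definition quot :: "'a \<Rightarrow> 'a" where
  "quot a = (SOME b. rel a b)"

lemma quot_eq_iff:
  assumes "a \<in> carrier A" "b \<in> carrier A"
  shows "quot a = quot b \<longleftrightarrow> rel a b"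
proof
  assume "quot a = quot b"
  moreover have "rel a (quot a)" "rel b (quot b)"
    unfolding quot_def using assms rel_refl by (auto intro: someI)
  ultimately show "rel a b"
    using rel_sym rel_trans by metis
next
  assume "rel a b"
  \<comment> \<open>Related elements define the same predicate, so the choice operator returns the
    same representative.\<close>
  then have "rel a = rel b"
    using rel_sym rel_trans by blast
  then show "quot a = quot b"
    by (simp add: quot_def)
qed

sublocale quot: mv_congruence A quot
  by unfold_locales (auto simp: quot_eq_iff rel_neg rel_plus)

text \<open>Every pair \<open>(g0 x, g1 x)\<close> comes from an element of \<open>R\<close>, and
  joint injectivity of \<open>f0\<close> and \<open>f1\<close> makes the lift a
  homomorphism.\<close>

lemma factor:
  assumes "mv_algebra X" "mv_hom X A g0" "mv_hom X A g1"
    "\<And>x. x \<in> carrier X \<Longrightarrow> rel (g0 x) (g1 x)"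
  obtains h where "mv_hom X R h" "\<And>x. x \<in> carrier X \<Longrightarrow> f0 (h x) = g0 x \<and> f1 (h x) = g1 x"
proof (rule mv_hom_factor[OF assms(1) R, where I = "UNIV :: bool set" and F = "\<lambda>_. A"
      and \<pi> = "\<lambda>i. if i then f0 else f1" and \<mu> = "\<lambda>i. if i then g0 else g1"])
  show "x = y" if "x \<in> carrier R" "y \<in> carrier R"
    "\<And>i. i \<in> UNIV \<Longrightarrow> (if i then f0 else f1) x = (if i then f0 else f1) y" for x y
    using that(1,2) that(3)[of True] that(3)[of False] by (simp add: inj)
  show "\<exists>x \<in> carrier R. \<forall>i \<in> UNIV. (if i then f0 else f1) x = (if i then g0 else g1) m"
    if "m \<in> carrier X" for m
    using assms(4)[OF that] by (simp add: rel_def all_bool_eq)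
next
  fix h assume h: "mv_hom X R h" "\<And>i m. i \<in> UNIV \<Longrightarrow> m \<in> carrier X \<Longrightarrow>
    (if i then f0 else f1) (h m) = (if i then g0 else g1) m"
  then show thesis
    using h(2)[of True] h(2)[of False] by (intro that[of h]) auto
qed (use hom0 hom1 assms(2,3) in auto)

end

text \<open>Each diagram condition is translated into one on \<open>rel\<close>, settled by the
  Maltsev term, and translated back to arrows by \<open>lift\<close>.\<close>

lemma reflexive_relation_MV_lf_imp_effective:
  fixes A :: "'a mv_alg"
  assumes inf: "infinite (UNIV :: 'a set)"
    and rr: "reflexive_relation MV_lf A P q0 q1 R p0 p1"
  shows "effective_equivalence_relation MV_lf A P q0 q1 R p0 p1"
proof -
  have rel: "is_relation MV_lf A P q0 q1 R p0 p1"
    using rr by (simp add: reflexive_relation_def)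
  have prod: "is_product MV_lf A A P q0 q1"
    and p0: "p0 \<in> Hom MV_lf R A" and p1: "p1 \<in> Hom MV_lf R A"
    and mono: "monic MV_lf (pairing MV_lf P q0 q1 p0 p1)"
    using rel by (auto simp: is_relation_def)
  note monicD = monic_pairingD[OF category_MV_lf prod p0 p1 mono]
  note factors = factors_through_pairing_iff[OF category_MV_lf prod p0 p1]
  have AOb: "A \<in> Ob MV_lf" and ROb: "R \<in> Ob MV_lf"
    using Hom_MV_lfD(1,2)[OF p0] by auto
  note Id = Id_MV_lf_Hom[OF AOb]
  obtain d where d: "d \<in> Hom MV_lf A R" "p0 \<cdot>\<^bsub>MV_lf\<^esub> d = Id MV_lf A" "p1 \<cdot>\<^bsub>MV_lf\<^esub> d = Id MV_lf A"
    using rr factors[OF Id Id] by (auto simp: reflexive_relation_def)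
  \<comment> \<open>Joint monicity yields joint injectivity, and \<open>d\<close>, which lifts the
    diagonal, supplies the witnesses of reflexivity.\<close>
  interpret mv_reflexive_relation A R "map_of_arrow p0" "map_of_arrow p1"
  proof (rule mv_reflexive_relation.intro)
    show "\<exists>r \<in> carrier R. map_of_arrow p0 r = a \<and> map_of_arrow p1 r = a" if "a \<in> carrier A" for a
      using d(2,3) Comp_MV_lf_eq_iff[OF d(1) p0 Id] Comp_MV_lf_eq_iff[OF d(1) p1 Id]
        Hom_MV_lfD(8)[OF d(1) that] that by (auto simp: Id_MV_lf)
    show "r = s" if "r \<in> carrier R" "s \<in> carrier R" "map_of_arrow p0 r = map_of_arrow p0 s"
      "map_of_arrow p1 r = map_of_arrow p1 s" for r s
      using jointly_monic_imp_injective[OF inf p0 p1 monicD that] .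
  qed (use Hom_MV_lfD[OF p0] Hom_MV_lfD[OF p1] in auto)
  have lift: "\<exists>h \<in> Hom MV_lf X R. p0 \<cdot>\<^bsub>MV_lf\<^esub> h = f \<and> p1 \<cdot>\<^bsub>MV_lf\<^esub> h = g"
    if f: "f \<in> Hom MV_lf X A" and g: "g \<in> Hom MV_lf X A"
      and fg: "\<And>x. x \<in> carrier X \<Longrightarrow> rel (map_of_arrow f x) (map_of_arrow g x)" for X f g
  proof -
    obtain h where h: "mv_hom X R h" "\<And>x. x \<in> carrier X \<Longrightarrow>
      map_of_arrow p0 (h x) = map_of_arrow f x \<and> map_of_arrow p1 (h x) = map_of_arrow g x"
      using factor[OF Hom_MV_lfD(3,7)[OF f] Hom_MV_lfD(7)[OF g] fg] by blast
    have H: "mv_arr X R h \<in> Hom MV_lf X R"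
      using Hom_MV_lfD(1)[OF f] ROb h(1) by (rule mv_arr_Hom)
    show ?thesis
      by (rule bexI[OF _ H]) (simp add: Comp_MV_lf_eq_iff[OF H p0 f] Comp_MV_lf_eq_iff[OF H p1 g] h)
  qed
  have "symmetric_relation MV_lf A P q0 q1 R p0 p1"
    unfolding symmetric_relation_def factors[OF p1 p0]
    using rel lift[OF p1 p0] relI rel_sym by blast
  moreover have "transitive_relation MV_lf A P q0 q1 R p0 p1"
    unfolding transitive_relation_def
  proof (intro conjI allI impI)
    fix T t0 t1 assume "is_pullback MV_lf p1 p0 T t0 t1"
    then have t0: "t0 \<in> Hom MV_lf T R" and t1: "t1 \<in> Hom MV_lf T R"
      and eq: "p1 \<cdot>\<^bsub>MV_lf\<^esub> t0 = p0 \<cdot>\<^bsub>MV_lf\<^esub> t1"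
      using Hom_MV_lfD(5)[OF p0] Hom_MV_lfD(5)[OF p1] by (auto simp: is_pullback_def)
    note H = Comp_MV_lf_Hom[OF t0 p0] Comp_MV_lf_Hom[OF t1 p1]
    show "factors_through MV_lf (pairing MV_lf P q0 q1 (p0 \<cdot>\<^bsub>MV_lf\<^esub> t0) (p1 \<cdot>\<^bsub>MV_lf\<^esub> t1))
      (pairing MV_lf P q0 q1 p0 p1)"
      unfolding factors[OF H]
    proof (rule lift[OF H])
      fix x assume x: "x \<in> carrier T"
      \<comment> \<open>Commutativity of the pullback square provides the common middle element for
        transitivity of \<open>rel\<close>.\<close>
      have "map_of_arrow p1 (map_of_arrow t0 x) = map_of_arrow p0 (map_of_arrow t1 x)"
        using eq Comp_MV_lf_apply[OF t0 x] Comp_MV_lf_apply[OF t1 x] by metis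
      then show "rel (map_of_arrow (p0 \<cdot>\<^bsub>MV_lf\<^esub> t0) x) (map_of_arrow (p1 \<cdot>\<^bsub>MV_lf\<^esub> t1) x)"
        using relI[OF Hom_MV_lfD(8)[OF t0 x]] relI[OF Hom_MV_lfD(8)[OF t1 x]]
        by (metis Comp_MV_lf_apply t0 t1 x rel_trans)
    qed
  qed (rule rel)
  moreover have "\<exists>S. \<exists>q \<in> Hom MV_lf A S. is_pullback MV_lf q q R p0 p1"
  proof -
    let ?S = "mv_image A quot"
    let ?q = "mv_arr A ?S quot"
    have "?S \<in> Ob MV_lf"
      using AOb quot.mv_algebra_image quot.locally_finite_mv_image by (simp add: Ob_MV_lf)
    then have q: "?q \<in> Hom MV_lf A ?S"
      using AOb quot.hom_image by (intro mv_arr_Hom)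
    \<comment> \<open>Arrows become equal after the quotient map exactly when they are pointwise
      related; so the kernel pair must classify pointwise related pairs of arrows, as
      \<open>R\<close> does.\<close>
    have q_eq_iff: "?q \<cdot>\<^bsub>MV_lf\<^esub> f = ?q \<cdot>\<^bsub>MV_lf\<^esub> g \<longleftrightarrow>
      (\<forall>x \<in> carrier X. rel (map_of_arrow f x) (map_of_arrow g x))"
      if "f \<in> Hom MV_lf X A" "g \<in> Hom MV_lf X A" for X f g
      unfolding Comp_MV_lf_eq_iff[OF that(1) q Comp_MV_lf_Hom[OF that(2) q]]
      using Hom_MV_lfD(8)[OF that(1)] Hom_MV_lfD(8)[OF that(2)]
      by (simp add: Comp_MV_lf_apply[OF that(2)] quot_eq_iff)
    have "is_pullback MV_lf ?q ?q R p0 p1"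
      unfolding is_pullback_def MV_lf_simps Hom_MV_lfD(5)[OF q]
    proof (intro conjI allI ballI impI)
      show "?q \<cdot>\<^bsub>MV_lf\<^esub> p0 = ?q \<cdot>\<^bsub>MV_lf\<^esub> p1"
        using relI by (simp add: q_eq_iff[OF p0 p1])
      fix X x0 x1 assume x: "x0 \<in> Hom MV_lf X A" "x1 \<in> Hom MV_lf X A"
        and "?q \<cdot>\<^bsub>MV_lf\<^esub> x0 = ?q \<cdot>\<^bsub>MV_lf\<^esub> x1"
      then show "\<exists>!h. h \<in> Hom MV_lf X R \<and> p0 \<cdot>\<^bsub>MV_lf\<^esub> h = x0 \<and> p1 \<cdot>\<^bsub>MV_lf\<^esub> h = x1"
        \<comment> \<open>\<open>lift\<close> gives existence of the mediating arrow, joint monicity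
          its uniqueness.\<close>
        using lift[OF x] q_eq_iff[OF x] monicD by metis
    qed (use p0 p1 Hom_MV_lfD[OF q] in auto)
    with q show ?thesis by blast
  qed
  ultimately show ?thesis
    using rr by (simp add: effective_equivalence_relation_def equivalence_relation_def)
qed

theorem corollary5p3:
  assumes "infinite (UNIV :: 'a set)"
  shows "(\<forall>A P q0 q1 R p0 p1.
            reflexive_relation (MV_lf :: ('a mv_alg, 'a mv_arrow) cat) A P q0 q1 R p0 p1 \<longrightarrow>
            effective_equivalence_relation MV_lf A P q0 q1 R p0 p1) \<and>
         maltsev_category (MV_lf :: ('a mv_alg, 'a mv_arrow) cat)"
  \<comment> \<open>Effectivity includes being an equivalence relation, so finite limits complete
    the Maltsev property.\<close>
  using reflexive_relation_MV_lf_imp_effective[OF assms] has_finite_limits_MV_lf[OF assms]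
    category_MV_lf
  unfolding maltsev_category_def effective_equivalence_relation_def by blast

end
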